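(* Let $n\ge 1$ be an integer. Then there is a bijection between the set $\mathcal{RG}_n$ of (labelled) Riordan graphs with $n$ vertices and the set $P_{2n}$ of permutations of $\{1,\ldots,2n\}$ that avoid both patterns $123$ and $132$ and have exactly two fixed points.
   Context: Riordan matrices: for formal power series $g=\sum_{k\ge 0}g_kt^k$ and $f=\sum_{k\ge 1}f_kt^k$ in $\mathbb{Z}[[t]]$ (so $f$ has zero constant term), the Riordan matrix $(g,f)$ is the infinite lower triangular matrix $[\ell_{ij}]_{i,j\ge 0}$ with $\ell_{ij}=[t^i]\,g f^j$, where $[t^k]$ denotes the coefficient of $t^k$. The $n\times n$ leading principal submatrix of $(g,f)$ is denoted $(g,f)_n$. Riordan graphs: a simple labelled graph $G$ on the vertex set $\{1,\ldots,n\}$ is a Riordan graph of order $n$ if there are $g\in\mathbb{Z}[[t]]$ and $f\in t\,\mathbb{Z}[[t]]$ such that its adjacency matrix (with entries in $\{0,1\}$) satisfies $$A(G)\equiv (tg,f)_n+(tg,f)_n^T \pmod 2 .$$ Equivalently, writing $A(G)=(a_{i,j})_{1\le i,j\le n}$, for all $i\ge j$ one has $a_{i,j}=a_{j,i}\equiv [t^{i-2}]\,g f^{j-1}\pmod 2$ (in particular the diagonal is zero). Graphs are labelled: two such graphs are the same if and only if they have the same adjacency matrix. $\mathcal{RG}_n$ denotes the set of all Riordan graphs with $n$ vertices. Pattern avoidance: a permutation $\pi=\pi_1\cdots\pi_m$ (one-line notation) contains a pattern $\tau=\tau_1\cdots\tau_k$ (a permutation of $\{1,\ldots,k\}$) if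 there are indices $1\le i_1<\cdots<i_k\le m$ such that $\pi_{i_1},\ldots,\pi_{i_k}$ are in the same relative order as $\tau_1,\ldots,\tau_k$; otherwise $\pi$ avoids $\tau$. A fixed point of $\pi$ is an index $i$ with $\pi_i=i$. *)

theory Defs
  imports
    "HOL-Combinatorics.Permutations"
    "HOL-Computational_Algebra.Formal_Power_Series"
    "HOL-Number_Theory.Cong"
    "Jordan_Normal_Form.Matrix"
    "Graph_Theory.Pair_Digraph"
begin

text \<open>The infinite matrix \<open>(g,f)\<close>, with rows and columns indexed from 0. That \<open>f\<close> has zero
  constant term is required where the matrix is used.\<close>

definition riordan_matrix :: "int fps \<Rightarrow> int fps \<Rightarrow> nat \<Rightarrow> nat \<Rightarrow> int" where
  "riordan_matrix g f i j = fps_nth (g * f ^ j) i"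

definition leading_submatrix :: "nat \<Rightarrow> (nat \<Rightarrow> nat \<Rightarrow> 'a) \<Rightarrow> 'a mat" where
  "leading_submatrix n L = mat n n (\<lambda>(i, j). L i j)"

text \<open>Simple undirected graphs are symmetric loop-free digraphs without parallel arcs, i.e.
  \<^locale>\<open>pair_graph\<close>: an edge \<open>{u, v}\<close> is the pair of arcs \<open>(u, v)\<close> and \<open>(v, u)\<close>. In the adjacency matrix
  the 0-based index \<open>i\<close> belongs to the vertex \<open>i + 1\<close>.\<close>

definition adjacency_matrix :: "nat \<Rightarrow> nat pair_pre_digraph \<Rightarrow> int mat" where
  "adjacency_matrix n G = mat n n (\<lambda>(i, j). if (i + 1, j + 1) \<in> parcs G then 1 else 0)"

definition mat_cong :: "int mat \<Rightarrow> int mat \<Rightarrow> int \<Rightarrow> bool" where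
  "mat_cong A B m \<longleftrightarrow> dim_row A = dim_row B \<and> dim_col A = dim_col B \<and>
     (\<forall>i < dim_row A. \<forall>j < dim_col A. [A $$ (i, j) = B $$ (i, j)] (mod m))"

definition riordan_graph :: "nat \<Rightarrow> nat pair_pre_digraph \<Rightarrow> bool" where
  "riordan_graph n G \<longleftrightarrow> pair_graph G \<and> pverts G = {1..n} \<and>
     (\<exists>g f :: int fps. fps_nth f 0 = 0 \<and>
        (let R = leading_submatrix n (riordan_matrix (fps_X * g) f)
         in mat_cong (adjacency_matrix n G) (R + transpose_mat R) 2))"

definition riordan_graphs :: "nat \<Rightarrow> nat pair_pre_digraph set" where
  "riordan_graphs n = {G. riordan_graph n G}"

text \<open>A permutation \<open>\<pi>\<close> of \<open>{1..m}\<close> is a function with \<open>\<pi> permutes {1..m}\<close>, hence the identity outside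
  \<open>{1..m}\<close>. A pattern \<open>\<tau>\<close> is given by its one-line notation; the indices
  \<open>\<iota> 0 < \<dots> < \<iota> (k - 1)\<close> with \<open>k = length \<tau>\<close> are the positions of an occurrence of \<open>\<tau>\<close> in \<open>\<pi>\<close>.\<close>

definition contains_pattern :: "nat \<Rightarrow> (nat \<Rightarrow> nat) \<Rightarrow> nat list \<Rightarrow> bool" where
  "contains_pattern m \<pi> \<tau> \<longleftrightarrow>
     (\<exists>\<iota> :: nat \<Rightarrow> nat. strict_mono_on {..<length \<tau>} \<iota> \<and> \<iota> ` {..<length \<tau>} \<subseteq> {1..m} \<and>
        (\<forall>a < length \<tau>. \<forall>b < length \<tau>. \<pi> (\<iota> a) < \<pi> (\<iota> b) \<longleftrightarrow> \<tau> ! a < \<tau> ! b))"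

definition avoids_pattern :: "nat \<Rightarrow> (nat \<Rightarrow> nat) \<Rightarrow> nat list \<Rightarrow> bool" where
  "avoids_pattern m \<pi> \<tau> \<longleftrightarrow> \<not> contains_pattern m \<pi> \<tau>"

definition fixed_points :: "nat \<Rightarrow> (nat \<Rightarrow> nat) \<Rightarrow> nat set" where
  "fixed_points m \<pi> = {i \<in> {1..m}. \<pi> i = i}"

definition avoiders_two_fixed :: "nat \<Rightarrow> (nat \<Rightarrow> nat) set" where
  "avoiders_two_fixed m = {\<pi>. \<pi> permutes {1..m} \<and> avoids_pattern m \<pi> [1, 2, 3] \<and>
     avoids_pattern m \<pi> [1, 3, 2] \<and> card (fixed_points m \<pi>) = 2}"

end

theory Submission
  imports Defs
begin

text \<open>Both sides are encoded by the same finite sets \<open>E\<close> of bars on the line \<open>0, \<dots>, 2n\<close>.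

  Avoiding 123 and 132 together means that every entry is exceeded by at most one later entry, so
  that, reading from the left, each entry is one of the two largest values not yet used. A
  permutation of \<open>{1..m}\<close> of this kind is therefore a concatenation of blocks: a block that occupies
  the positions \<open>p + 1, \<dots>, p + l\<close> has the entries
  \<open>m - p - 1, m - p - 2, \<dots>, m - p - l + 1, m - p\<close>. The block boundaries \<open>0\<close>, \<dots>, \<open>m\<close> are the bars, and
  they can be any set that contains \<open>0\<close> and \<open>m\<close>. For \<open>m = 2n\<close> an entry that does not end its block is fixed only at
  position \<open>n\<close>, and the last entry of a block is fixed only if the block is centred, that is, runs
  from \<open>n - q\<close> to \<open>n + q\<close> for some \<open>q \<ge> 1\<close>. A centred block contains position \<open>n\<close> before its end, hence
  exactly two fixed points occur precisely when a centred block exists.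

  On the graph side everything depends only on the parities of the coefficients. Let \<open>q\<close> be the
  least index below \<open>n\<close> at which \<open>tg\<close> has an odd coefficient, and \<open>q = n\<close> if there is none. Below
  the diagonal, the columns of the adjacency matrix are \<open>tg\<close>, \<open>tgf\<close>, \<open>tgf\<^sup>2\<close>, \<open>\<dots>\<close> modulo 2. From the
  first one the graph determines the parities of \<open>tg\<close> below degree \<open>n\<close>. Cancelling \<open>tg\<close> from the
  second one leaves exactly the parities of \<open>f\<close> below degree \<open>n - q\<close>, and with those of \<open>tg\<close> they in
  turn determine every column \<open>tgf\<^sup>j\<close> below degree \<open>n\<close> (lemmas \<open>even_below_mult_cancel\<close> and \<open>even_below_mult_power_diff\<close>).

  The two descriptions match: the bars between \<open>n\<close> and \<open>2n\<close> record the odd coefficients of \<open>tg\<close>, so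
  that the first bar above \<open>n\<close> is \<open>n + q\<close>; the centred block begins at its mirror image \<open>n - q\<close>; and
  the bars between \<open>0\<close> and \<open>n - q\<close> record the odd coefficients of \<open>f\<close>.\<close>

section \<open>Permutations avoiding 123 and 132\<close>

definition bar_sets :: "nat \<Rightarrow> nat set set" where
  "bar_sets m = {E. 0 \<in> E \<and> m \<in> E \<and> E \<subseteq> {0..m}}"

definition prev_bar :: "nat set \<Rightarrow> nat \<Rightarrow> nat" where
  "prev_bar E i = Max {e \<in> E. e < i}"

text \<open>Among the positions \<open>1, \<dots>, m\<close>, the bars are the last positions of the blocks.\<close>

definition perm_of_bars :: "nat \<Rightarrow> nat set \<Rightarrow> nat \<Rightarrow> nat" where
  "perm_of_bars m E i =
     (if i \<in> {1..m} then if i \<in> E then m - prev_bar E i else m - i else i)"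

text \<open>The point \<open>0\<close> is a bar because a permutation of \<open>{1..m}\<close> fixes \<open>0\<close> and \<open>m > 0\<close>, and \<open>m\<close> is a bar because
  the value \<open>m - m = 0\<close> is not attained on \<open>{1..m}\<close>; so both ends need no separate clause.\<close>

definition bars_of_perm :: "nat \<Rightarrow> (nat \<Rightarrow> nat) \<Rightarrow> nat set" where
  "bars_of_perm m \<pi> = {i \<in> {0..m}. \<pi> i \<noteq> m - i}"

definition at_most_one_later_greater :: "nat \<Rightarrow> (nat \<Rightarrow> nat) \<Rightarrow> bool" where
  "at_most_one_later_greater m \<pi> \<longleftrightarrow>
     (\<forall>i j k. 1 \<le> i \<and> i < j \<and> j < k \<and> k \<le> m \<longrightarrow> \<not> (\<pi> i < \<pi> j \<and> \<pi> i < \<pi> k))"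

lemma contains_pattern_length_3:
  "contains_pattern m \<pi> [x, y, z] \<longleftrightarrow>
     (\<exists>i j k. 1 \<le> i \<and> i < j \<and> j < k \<and> k \<le> m \<and>
        (\<pi> i < \<pi> j \<longleftrightarrow> x < y) \<and> (\<pi> j < \<pi> i \<longleftrightarrow> y < x) \<and>
        (\<pi> i < \<pi> k \<longleftrightarrow> x < z) \<and> (\<pi> k < \<pi> i \<longleftrightarrow> z < x) \<and>
        (\<pi> j < \<pi> k \<longleftrightarrow> y < z) \<and> (\<pi> k < \<pi> j \<longleftrightarrow> z < y))"
    (is "?L \<longleftrightarrow> ?R")
proof
  have len: "length [x, y, z] = 3" by simp
  assume ?L
  then obtain \<iota> where mono: "strict_mono_on {..<3::nat} \<iota>" and ran: "\<iota> ` {..<3} \<subseteq> {1..m}"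
    and ord: "\<forall>a<3. \<forall>b<3. \<pi> (\<iota> a) < \<pi> (\<iota> b) \<longleftrightarrow> [x, y, z] ! a < [x, y, z] ! b"
    unfolding contains_pattern_def len by (elim exE conjE) (rule that)
  have "\<iota> 0 < \<iota> 1" "\<iota> 1 < \<iota> 2"
    using strict_mono_onD[OF mono, of 0 1] strict_mono_onD[OF mono, of 1 2] by auto
  moreover have "1 \<le> \<iota> 0" "\<iota> 2 \<le> m"
    using ran by (auto simp: image_subset_iff)
  ultimately show ?R
    by (intro exI[of _ "\<iota> 0"] exI[of _ "\<iota> 1"] exI[of _ "\<iota> 2"] conjI) (simp_all add: ord)
next
  assume ?R
  then obtain i j k where pos: "1 \<le> i" "i < j" "j < k" "k \<le> m"
    and ord: "\<pi> i < \<pi> j \<longleftrightarrow> x < y" "\<pi> j < \<pi> i \<longleftrightarrow> y < x"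
      "\<pi> i < \<pi> k \<longleftrightarrow> x < z" "\<pi> k < \<pi> i \<longleftrightarrow> z < x"
      "\<pi> j < \<pi> k \<longleftrightarrow> y < z" "\<pi> k < \<pi> j \<longleftrightarrow> z < y"
    by blast
  have three: "a < length [x, y, z] \<longleftrightarrow> a = 0 \<or> a = 1 \<or> a = 2" for a
    by auto
  have set_three: "{..<length [x, y, z]} = {0, 1, 2}"
    by auto
  have "strict_mono_on {0, 1, 2} (\<lambda>a. [i, j, k] ! a)"
    using pos by (auto simp: strict_mono_on_def)
  moreover have "(\<lambda>a. [i, j, k] ! a) ` {0, 1, 2} \<subseteq> {1..m}"
    using pos by auto
  moreover have "\<pi> ([i, j, k] ! a) < \<pi> ([i, j, k] ! b) \<longleftrightarrow> [x, y, z] ! a < [x, y, z] ! b"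
    if "a = 0 \<or> a = 1 \<or> a = 2" "b = 0 \<or> b = 1 \<or> b = 2" for a b
    using that ord by (elim disjE) simp_all
  ultimately show ?L
    unfolding contains_pattern_def three set_three by blast
qed

text \<open>In a triple whose first entry is the smallest, the other two entries are in one of two orders:
  the two patterns are these two cases.\<close>

lemma avoids_123_132_iff:
  assumes "inj_on \<pi> {1..m}"
  shows "avoids_pattern m \<pi> [1, 2, 3] \<and> avoids_pattern m \<pi> [1, 3, 2] \<longleftrightarrow>
     at_most_one_later_greater m \<pi>"
proof -
  have ne: "\<pi> j \<noteq> \<pi> k" if "1 \<le> i" "i < j" "j < k" "k \<le> m" for i j k
    using inj_onD[OF assms, of j k] that by auto
  have later: "\<pi> i < \<pi> j \<and> \<pi> i < \<pi> k \<longleftrightarrow>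
      \<pi> i < \<pi> j \<and> \<pi> j < \<pi> k \<or> \<pi> i < \<pi> k \<and> \<pi> k < \<pi> j"
    if "1 \<le> i \<and> i < j \<and> j < k \<and> k \<le> m" for i j k
    using ne[of i j k] that by linarith
  have "contains_pattern m \<pi> [1, 2, 3] \<longleftrightarrow>
      (\<exists>i j k. 1 \<le> i \<and> i < j \<and> j < k \<and> k \<le> m \<and> \<pi> i < \<pi> j \<and> \<pi> j < \<pi> k)"
    unfolding contains_pattern_length_3 by (intro ex_cong1) auto
  moreover have "contains_pattern m \<pi> [1, 3, 2] \<longleftrightarrow>
      (\<exists>i j k. 1 \<le> i \<and> i < j \<and> j < k \<and> k \<le> m \<and> \<pi> i < \<pi> k \<and> \<pi> k < \<pi> j)"
    unfolding contains_pattern_length_3 by (intro ex_cong1) auto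
  ultimately have "contains_pattern m \<pi> [1, 2, 3] \<or> contains_pattern m \<pi> [1, 3, 2] \<longleftrightarrow>
      \<not> at_most_one_later_greater m \<pi>"
    unfolding at_most_one_later_greater_def
    using later by blast
  then show ?thesis
    unfolding avoids_pattern_def by blast
qed

lemma prev_bar:
  assumes "0 \<in> E" "0 < i"
  shows prev_bar_mem: "prev_bar E i \<in> E" and prev_bar_less: "prev_bar E i < i"
proof -
  have "prev_bar E i \<in> {e \<in> E. e < i}"
    unfolding prev_bar_def using assms by (intro Max_in) auto
  then show "prev_bar E i \<in> E" "prev_bar E i < i"
    by auto
qed

lemma prev_bar_ge: "e \<in> E \<Longrightarrow> e < i \<Longrightarrow> e \<le> prev_bar E i"
  unfolding prev_bar_def by (intro Max_ge) auto

lemma prev_bar_eqI: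
  assumes "p \<in> E" "p < i" "\<And>e. e \<in> E \<Longrightarrow> e < i \<Longrightarrow> e \<le> p"
  shows "prev_bar E i = p"
  unfolding prev_bar_def using assms by (intro Max_eqI) auto

lemma prev_bar_Suc:
  assumes "0 \<in> E"
  shows "prev_bar E (Suc i) = (if i \<in> E then i else prev_bar E i)"
proof (cases "i \<in> E")
  case False
  then have "0 < i"
    using assms by (cases i) auto
  with False show ?thesis
    using prev_bar_mem[OF assms, of i] prev_bar_less[OF assms, of i] prev_bar_ge[of _ E i]
    by (auto simp: less_Suc_eq intro!: prev_bar_eqI)
qed (auto intro: prev_bar_eqI)

text \<open>The maximum of a block stands at its end, and all later blocks have smaller values.\<close>

lemma bar_value_greater_later:
  assumes E: "E \<in> bar_sets m" and i: "1 \<le> i" "i < j" "j \<le> m" "i \<in> E"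
  shows "perm_of_bars m E j < perm_of_bars m E i"
proof -
  have "0 \<in> E" using E by (simp add: bar_sets_def)
  then have "prev_bar E i < i" "i \<le> prev_bar E j" "prev_bar E j < j"
    using i prev_bar_less[of E i] prev_bar_less[of E j] prev_bar_ge[of i E j] by auto
  then show ?thesis
    using i by (auto simp: perm_of_bars_def)
qed

text \<open>Only the end of the block that contains position \<open>i\<close> can carry a larger value than position \<open>i\<close>
  and come after it. As the bound is not strict, the same argument yields injectivity.\<close>

lemma later_greater_imp_next_bar:
  assumes E: "E \<in> bar_sets m" and i: "1 \<le> i" "i < j" "j \<le> m"
    and le: "perm_of_bars m E i \<le> perm_of_bars m E j"
  shows "i \<notin> E" "j \<in> E" "prev_bar E j < i" "perm_of_bars m E i \<noteq> perm_of_bars m E j"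
proof -
  have z: "0 \<in> E" using E by (simp add: bar_sets_def)
  show iE: "i \<notin> E"
    using bar_value_greater_later[OF E i] le by auto
  show jE: "j \<in> E"
    using iE i le by (auto simp: perm_of_bars_def split: if_splits)
  have "prev_bar E j < j" "prev_bar E j \<in> E"
    using z i prev_bar_less[of E j] prev_bar_mem[of E j] by auto
  moreover from this have "prev_bar E j \<noteq> i"
    using iE by auto
  ultimately show "prev_bar E j < i" "perm_of_bars m E i \<noteq> perm_of_bars m E j"
    using iE jE i le by (auto simp: perm_of_bars_def)
qed

lemma inj_on_perm_of_bars:
  assumes "E \<in> bar_sets m"
  shows "inj_on (perm_of_bars m E) {1..m}"
proof (rule linorder_inj_onI)
  fix i j assume "i < j" "i \<in> {1..m}" "j \<in> {1..m}"
  then show "perm_of_bars m E i \<noteq> perm_of_bars m E j"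
    using later_greater_imp_next_bar(4)[OF assms, of i j] by auto
qed auto

lemma perm_of_bars_permutes:
  assumes E: "E \<in> bar_sets m"
  shows "perm_of_bars m E permutes {1..m}"
proof (rule bij_imp_permutes)
  have "perm_of_bars m E i \<in> {1..m}" if i: "i \<in> {1..m}" for i
  proof -
    have "0 \<in> E" "m \<in> E" using E by (auto simp: bar_sets_def)
    then have "prev_bar E i < i" "i \<notin> E \<Longrightarrow> i \<noteq> m"
      using i prev_bar_less[of E i] by auto
    then show ?thesis
      using i by (auto simp: perm_of_bars_def)
  qed
  then have "perm_of_bars m E ` {1..m} \<subseteq> {1..m}"
    by blast
  then show "bij_betw (perm_of_bars m E) {1..m} {1..m}"
    using inj_on_perm_of_bars[OF E] endo_inj_surj[of "{1..m}" "perm_of_bars m E"]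
    unfolding bij_betw_def by blast
qed (auto simp: perm_of_bars_def)

lemma perm_of_bars_at_most_one_later_greater:
  assumes E: "E \<in> bar_sets m"
  shows "at_most_one_later_greater m (perm_of_bars m E)"
  unfolding at_most_one_later_greater_def
proof (intro allI impI notI, elim conjE)
  fix i j k
  assume "1 \<le> i" "i < j" "j < k" "k \<le> m"
    and "perm_of_bars m E i < perm_of_bars m E j" "perm_of_bars m E i < perm_of_bars m E k"
  then have "j \<in> E" "prev_bar E k < i"
    using later_greater_imp_next_bar[OF E, of i j] later_greater_imp_next_bar[OF E, of i k]
    by auto
  then show False
    using prev_bar_ge[of j E k] \<open>i < j\<close> \<open>j < k\<close> by auto
qed

lemma bars_of_perm_of_bars:
  assumes E: "E \<in> bar_sets m" and "0 < m"
  shows "bars_of_perm m (perm_of_bars m E) = E"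
proof -
  have z: "0 \<in> E" "E \<subseteq> {0..m}" using E by (auto simp: bar_sets_def)
  have "perm_of_bars m E i \<noteq> m - i \<longleftrightarrow> i \<in> E" if "i \<le> m" for i
    using that z prev_bar_less[of E i] \<open>0 < m\<close> by (cases "i = 0") (auto simp: perm_of_bars_def)
  with z(2) show ?thesis
    unfolding bars_of_perm_def by fastforce
qed

lemma bars_of_perm_mem:
  assumes "\<pi> permutes {1..m}" "0 < m"
  shows "bars_of_perm m \<pi> \<in> bar_sets m"
proof -
  have "\<pi> 0 = 0" "\<pi> m \<in> {1..m}"
    using assms permutes_in_image[OF assms(1), of m] by (auto simp: permutes_def)
  then show ?thesis
    using assms(2) by (auto simp: bar_sets_def bars_of_perm_def)
qed

text \<open>If the first \<open>i\<close> entries use up all of the \<open>i + 1\<close> largest values except for \<open>m - p\<close>, then the two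
  largest free values are \<open>m - p\<close> and \<open>m - i - 1\<close>. An entry smaller than both would have two larger
  entries after it. (For \<open>i + 1 = m\<close> only \<open>m - p\<close> is free.)\<close>

lemma next_value_avoider:
  assumes perm: "\<pi> permutes {1..m}" and later: "at_most_one_later_greater m \<pi>"
    and i: "i < m" and p: "p \<le> i"
    and img: "\<pi> ` {1..i} = {m - i..m} - {m - p}"
  shows "\<pi> (Suc i) = m - Suc i \<or> \<pi> (Suc i) = m - p"
proof (rule ccontr)
  assume neg: "\<not> ?thesis"
  have inj: "inj \<pi>" and range: "\<pi> ` {1..m} = {1..m}"
    using perm by (auto simp: permutes_inj permutes_image)
  have "\<pi> (Suc i) \<in> {1..m}"
    using permutes_in_image[OF perm, of "Suc i"] i by simp
  moreover have "\<pi> (Suc i) \<notin> \<pi> ` {1..i}"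
    by (simp add: inj_image_mem_iff[OF inj])
  then have "\<pi> (Suc i) < m - i \<or> m < \<pi> (Suc i) \<or> \<pi> (Suc i) = m - p"
    unfolding img by (simp only: Diff_iff atLeastAtMost_iff singleton_iff) linarith
  ultimately have small: "\<pi> (Suc i) < m - Suc i" "1 \<le> \<pi> (Suc i)"
    using neg i by auto
  have later_pos: "\<exists>k. Suc i < k \<and> k \<le> m \<and> \<pi> k = v"
    if v: "v \<in> {1..m}" "v \<notin> {m - i..m} - {m - p}" "v \<noteq> \<pi> (Suc i)" for v
  proof -
    obtain k where k: "k \<in> {1..m}" "\<pi> k = v"
      using v(1) range by (metis imageE)
    have "k \<notin> {1..i}"
      using v(2) k(2) unfolding img[symmetric] by blast
    moreover have "k \<noteq> Suc i"
      using v(3) k(2) by blast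
    ultimately show ?thesis
      using k by (intro exI[of _ k]) auto
  qed
  obtain j where j: "Suc i < j" "j \<le> m" "\<pi> j = m - Suc i"
    using later_pos[of "m - Suc i"] small i by auto
  obtain k where k: "Suc i < k" "k \<le> m" "\<pi> k = m - p"
  proof -
    have "m - p \<in> {1..m}" "m - p \<noteq> \<pi> (Suc i)"
      using small i p by auto
    then show ?thesis
      using later_pos[of "m - p"] that by blast
  qed
  have "j \<noteq> k"
    using j k i p by auto
  then consider "j < k" | "k < j" by linarith
  then show False
  proof cases
    case 1
    then show False
      using later[unfolded at_most_one_later_greater_def, rule_format, of "Suc i" j k] j k small p
      by auto
  next
    case 2
    then show False
      using later[unfolded at_most_one_later_greater_def, rule_format, of "Suc i" k j] j k small p
      by auto
  qed
qed

text \<open>The entries read so far always leave exactly one gap among the largest values, namely the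
  maximum of the current block, which is determined by the last bar. So each entry is one of two
  values, and the bars record which.\<close>

lemma perm_of_bars_of_perm:
  assumes perm: "\<pi> permutes {1..m}" and later: "at_most_one_later_greater m \<pi>" and "0 < m"
  shows "perm_of_bars m (bars_of_perm m \<pi>) = \<pi>"
proof -
  define E where "E = bars_of_perm m \<pi>"
  have z: "0 \<in> E"
    using bars_of_perm_mem[OF perm \<open>0 < m\<close>] by (simp add: E_def bar_sets_def)
  have memE: "i \<in> E \<longleftrightarrow> \<pi> i \<noteq> m - i" if "i \<le> m" for i
    using that by (simp add: E_def bars_of_perm_def)
  \<comment> \<open>The previous bar is taken at \<open>i + 1\<close>, so that a bar at \<open>i\<close> itself counts.\<close>
  have img: "\<pi> ` {1..i} = {m - i..m} - {m - prev_bar E (Suc i)}" if "i \<le> m" for i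
    using that
  proof (induction i)
    case 0
    then show ?case
      using z by (simp add: prev_bar_Suc)
  next
    case (Suc i)
    let ?p = "prev_bar E (Suc i)"
    have p: "?p \<le> i"
      using prev_bar_less[OF z, of "Suc i"] by simp
    have IH: "\<pi> ` {1..i} = {m - i..m} - {m - ?p}"
      using Suc by simp
    have insert: "\<pi> ` {1..Suc i} = insert (\<pi> (Suc i)) (\<pi> ` {1..i})"
      by (simp add: atLeastAtMostSuc_conv)
    have interval: "{m - Suc i..m} = insert (m - Suc i) {m - i..m}"
      using Suc.prems by auto
    from next_value_avoider[OF perm later _ p IH] Suc.prems
    consider (gap) "\<pi> (Suc i) = m - Suc i" | (bar) "\<pi> (Suc i) = m - ?p"
      by auto
    then show ?case
    proof cases
      case gap
      then have "Suc i \<notin> E"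
        using memE Suc.prems by simp
      then have "prev_bar E (Suc (Suc i)) = ?p"
        using z by (simp add: prev_bar_Suc[of E "Suc i"])
      then show ?thesis
        unfolding insert IH interval gap using p Suc.prems by auto
    next
      case bar
      then have "Suc i \<in> E"
        using memE Suc.prems p by auto
      then have "prev_bar E (Suc (Suc i)) = Suc i"
        using z by (simp add: prev_bar_Suc[of E "Suc i"])
      then show ?thesis
        unfolding insert IH interval bar using p Suc.prems by auto
    qed
  qed
  have "perm_of_bars m E i = \<pi> i" for i
  proof (cases "i \<in> {1..m}")
    case True
    then obtain i' where i': "i = Suc i'" "i' < m"
      by (cases i) auto
    have "prev_bar E (Suc i') \<le> i'"
      using prev_bar_less[OF z, of "Suc i'"] by simp
    from next_value_avoider[OF perm later i'(2) this img] i' memE[of i]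
    show ?thesis
      by (auto simp: perm_of_bars_def)
  next
    case False
    then show ?thesis
      using perm by (auto simp: perm_of_bars_def permutes_def)
  qed
  then show ?thesis
    by (auto simp: E_def)
qed

section \<open>Two fixed points\<close>

definition central_part :: "nat \<Rightarrow> nat set \<Rightarrow> nat \<Rightarrow> bool" where
  "central_part n E q \<longleftrightarrow> 1 \<le> q \<and> q \<le> n \<and> n - q \<in> E \<and> n + q \<in> E \<and>
     (\<forall>e \<in> E. \<not> (n - q < e \<and> e < n + q))"

definition central_bar_sets :: "nat \<Rightarrow> nat set set" where
  "central_bar_sets n = {E \<in> bar_sets (2 * n). \<exists>q. central_part n E q}"

text \<open>Inside a block the value at \<open>i\<close> is \<open>2n - i\<close>, which is \<open>i\<close> only for \<open>i = n\<close>. At a bar \<open>i\<close> the value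
  is \<open>i\<close> only if the previous bar is \<open>2n - i\<close>, the mirror image of \<open>i\<close> in \<open>n\<close>.\<close>

lemma fixed_points_perm_of_bars:
  assumes E: "E \<in> bar_sets (2 * n)" and "1 \<le> n"
  shows "fixed_points (2 * n) (perm_of_bars (2 * n) E) =
    (if n \<in> E then {} else {n}) \<union> {n + q | q. central_part n E q}"
proof -
  have z: "0 \<in> E" "2 * n \<in> E" "E \<subseteq> {0..2 * n}" using E by (auto simp: bar_sets_def)
  have bar: "perm_of_bars (2 * n) E i = i \<longleftrightarrow> (\<exists>q. i = n + q \<and> central_part n E q)"
    if i: "i \<in> {1..2 * n}" "i \<in> E" for i
  proof
    assume "perm_of_bars (2 * n) E i = i"
    moreover have p: "prev_bar E i < i" "prev_bar E i \<in> E"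
      using i z prev_bar_less[of E i] prev_bar_mem[of E i] by auto
    ultimately have eq: "prev_bar E i = 2 * n - i"
      using i by (auto simp: perm_of_bars_def)
    then have "n < i" using p i by auto
    then have "n - (i - n) = prev_bar E i" "n + (i - n) = i" using eq i by auto
    then have "central_part n E (i - n)"
      using p i \<open>n < i\<close> prev_bar_ge[of _ E i]
      by (auto simp: central_part_def not_less)
    then show "\<exists>q. i = n + q \<and> central_part n E q"
      using \<open>n < i\<close> by (intro exI[of _ "i - n"]) simp
  next
    assume "\<exists>q. i = n + q \<and> central_part n E q"
    then obtain q where q: "i = n + q" "central_part n E q" by blast
    then have "prev_bar E i = n - q"
      by (intro prev_bar_eqI) (auto simp: central_part_def not_less)
    then show "perm_of_bars (2 * n) E i = i"
      using i q by (auto simp: perm_of_bars_def central_part_def)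
  qed
  have gap: "perm_of_bars (2 * n) E i = i \<longleftrightarrow> i = n" if "i \<in> {1..2 * n}" "i \<notin> E" for i
    using that by (auto simp: perm_of_bars_def)
  have "i \<in> fixed_points (2 * n) (perm_of_bars (2 * n) E) \<longleftrightarrow>
      (n \<notin> E \<and> i = n) \<or> (\<exists>q. i = n + q \<and> central_part n E q)" for i
  proof (cases "i \<in> {1..2 * n}")
    case True
    then show ?thesis
      using bar[OF True] gap[OF True]
      by (cases "i \<in> E") (auto simp: fixed_points_def central_part_def)
  next
    case False
    then show ?thesis
      using \<open>1 \<le> n\<close> by (auto simp: fixed_points_def central_part_def)
  qed
  then show ?thesis by auto
qed

lemma central_part_unique:
  assumes "central_part n E q" "central_part n E r"
  shows "q = r"
proof (rule ccontr)
  assume "q \<noteq> r"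
  then consider "q < r" | "r < q" by linarith
  then show False
    using assms by cases (auto simp: central_part_def)
qed

text \<open>There is at most one centred block, and if there is one then \<open>n\<close> lies strictly between its bars;
  hence the fixed point \<open>n\<close> comes with every fixed point at a bar.\<close>

lemma card_fixed_points_perm_of_bars:
  assumes E: "E \<in> bar_sets (2 * n)" and "1 \<le> n"
  shows "card (fixed_points (2 * n) (perm_of_bars (2 * n) E)) = 2 \<longleftrightarrow>
    E \<in> central_bar_sets n"
proof (cases "\<exists>q. central_part n E q")
  case True
  then obtain q where q: "central_part n E q" by blast
  then have "n \<notin> E" "1 \<le> q"
    by (auto simp: central_part_def)
  moreover have "{n + q | q. central_part n E q} = {n + q}"
    using q central_part_unique by blast
  ultimately show ?thesis
    using q E by (auto simp: fixed_points_perm_of_bars[OF assms] central_bar_sets_def)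
next
  case False
  then show ?thesis
    by (auto simp: fixed_points_perm_of_bars[OF assms] central_bar_sets_def)
qed

lemma bij_betw_central_bar_sets_avoiders:
  assumes "1 \<le> n"
  shows "bij_betw (perm_of_bars (2 * n)) (central_bar_sets n) (avoiders_two_fixed (2 * n))"
proof (rule bij_betw_byWitness[where f' = "bars_of_perm (2 * n)"])
  have pos: "0 < 2 * n" using assms by simp
  have avoiders: "\<pi> \<in> avoiders_two_fixed (2 * n) \<longleftrightarrow> \<pi> permutes {1..2 * n} \<and>
      at_most_one_later_greater (2 * n) \<pi> \<and> card (fixed_points (2 * n) \<pi>) = 2" for \<pi>
    using avoids_123_132_iff[of \<pi> "2 * n"]
    by (auto simp: avoiders_two_fixed_def dest: permutes_inj_on)
  show "\<forall>E \<in> central_bar_sets n. bars_of_perm (2 * n) (perm_of_bars (2 * n) E) = E"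
    using bars_of_perm_of_bars[OF _ pos] by (auto simp: central_bar_sets_def)
  show inv: "\<forall>\<pi> \<in> avoiders_two_fixed (2 * n). perm_of_bars (2 * n) (bars_of_perm (2 * n) \<pi>) = \<pi>"
    using perm_of_bars_of_perm[OF _ _ pos] avoiders by auto
  show "perm_of_bars (2 * n) ` central_bar_sets n \<subseteq> avoiders_two_fixed (2 * n)"
  proof clarify
    fix E assume E: "E \<in> central_bar_sets n"
    then have "E \<in> bar_sets (2 * n)" by (simp add: central_bar_sets_def)
    with E show "perm_of_bars (2 * n) E \<in> avoiders_two_fixed (2 * n)"
      using perm_of_bars_permutes perm_of_bars_at_most_one_later_greater
        card_fixed_points_perm_of_bars[OF _ assms] avoiders by blast
  qed
  show "bars_of_perm (2 * n) ` avoiders_two_fixed (2 * n) \<subseteq> central_bar_sets n"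
  proof clarify
    fix \<pi> assume \<pi>: "\<pi> \<in> avoiders_two_fixed (2 * n)"
    then have E: "bars_of_perm (2 * n) \<pi> \<in> bar_sets (2 * n)"
      using bars_of_perm_mem[OF _ pos] avoiders by auto
    show "bars_of_perm (2 * n) \<pi> \<in> central_bar_sets n"
      using card_fixed_points_perm_of_bars[OF E assms] inv \<pi> avoiders by auto
  qed
qed

section \<open>Power series modulo 2\<close>

definition even_below :: "nat \<Rightarrow> int fps \<Rightarrow> bool" where
  "even_below q a \<longleftrightarrow> (\<forall>i < q. even (fps_nth a i))"

text \<open>In the convolution at degree \<open>q + r\<close> every term except the one that pairs the degrees \<open>q\<close> and
  \<open>r\<close> has an even factor. That 2 is prime then gives the equivalence, from which both the
  product rule and the cancellation rule for parities follow.\<close>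

lemma even_below_mult_lowest:
  assumes a: "even_below q a" and b: "even_below r b"
  shows "even (fps_nth (a * b) (q + r)) \<longleftrightarrow> even (fps_nth a q) \<or> even (fps_nth b r)"
proof -
  let ?t = "\<lambda>i. fps_nth a i * fps_nth b (q + r - i)"
  have "fps_nth (a * b) (q + r) = (\<Sum>i = 0..q + r. ?t i)"
    by (simp add: fps_mult_nth)
  also have "\<dots> = ?t q + (\<Sum>i \<in> {0..q + r} - {q}. ?t i)"
    by (subst sum.remove[of _ q]) auto
  finally have eq: "fps_nth (a * b) (q + r) = ?t q + (\<Sum>i \<in> {0..q + r} - {q}. ?t i)" .
  have "even (\<Sum>i \<in> {0..q + r} - {q}. ?t i)"
  proof (rule dvd_sum)
    fix i assume i: "i \<in> {0..q + r} - {q}"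
    show "even (?t i)"
    proof (cases "i < q")
      case True
      then show ?thesis using a by (simp add: even_below_def)
    next
      case False
      then have "q + r - i < r" using i by auto
      then show ?thesis using b by (simp add: even_below_def)
    qed
  qed
  then show ?thesis
    unfolding eq by simp
qed

lemma even_below_mult:
  assumes a: "even_below q a" and b: "even_below r b"
  shows "even_below (q + r) (a * b)"
  unfolding even_below_def
proof (intro allI impI)
  fix i assume i: "i < q + r"
  show "even (fps_nth (a * b) i)"
  proof (cases "i < q")
    case True
    have "even_below i a" "even_below 0 b" "even (fps_nth a i)"
      using True a by (auto simp: even_below_def)
    then show ?thesis
      using even_below_mult_lowest[of i a 0 b] by simp
  next
    case False
    have "even_below (i - q) b" "even (fps_nth b (i - q))"
      using False i b by (auto simp: even_below_def)
    then show ?thesis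
      using even_below_mult_lowest[OF a, of "i - q" b] False by simp
  qed
qed

lemma even_below_power_diff:
  assumes "even_below r (f - f')"
  shows "even_below r (f ^ j - f' ^ j)"
proof -
  have "f ^ j - f' ^ j = (f - f') * (\<Sum>i<j. f' ^ (j - Suc i) * f ^ i)"
    by (rule power_diff_sumr2)
  then show ?thesis
    using even_below_mult[OF assms, of 0] by (simp add: even_below_def)
qed

text \<open>Since the coefficients of \<open>a\<close> below \<open>q\<close> are even, those of \<open>f\<close> from degree \<open>n - q\<close> on have no
  influence on the parities of \<open>a f\<^sup>j\<close> below degree \<open>n\<close>.\<close>

lemma even_below_mult_power_diff:
  assumes a: "even_below q a" and aa': "even_below n (a - a')"
    and ff': "even_below (n - q) (f - f')"
  shows "even_below n (a * f ^ j - a' * f' ^ j)"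
proof -
  have "a * f ^ j - a' * f' ^ j = a * (f ^ j - f' ^ j) + (a - a') * f' ^ j"
    by (simp add: algebra_simps)
  moreover have "even_below (q + (n - q)) (a * (f ^ j - f' ^ j))"
    by (intro even_below_mult a even_below_power_diff ff')
  moreover have "even_below (n + 0) ((a - a') * f' ^ j)"
    by (intro even_below_mult aa') (simp add: even_below_def)
  ultimately show ?thesis
    by (auto simp: even_below_def)
qed

text \<open>The converse of \<open>even_below_mult\<close> for a factor with an odd coefficient at \<open>q\<close>: modulo 2
  such a factor is \<open>t\<^sup>q\<close> times a unit.\<close>

lemma even_below_mult_cancel:
  assumes a: "even_below q a" "odd (fps_nth a q)" and ab: "even_below n (a * b)"
  shows "even_below (n - q) b"
  unfolding even_below_def
proof (intro allI)
  fix i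
  show "i < n - q \<longrightarrow> even (fps_nth b i)"
  proof (induction i rule: less_induct)
    case (less i)
    show ?case
    proof
      assume i: "i < n - q"
      then have "even_below i b"
        using less by (auto simp: even_below_def)
      moreover have "even (fps_nth (a * b) (q + i))"
        using ab i by (auto simp: even_below_def)
      ultimately show "even (fps_nth b i)"
        using even_below_mult_lowest[OF a(1)] a(2) by blast
    qed
  qed
qed

section \<open>Riordan graphs\<close>

definition riordan_graph_of :: "nat \<Rightarrow> int fps \<Rightarrow> int fps \<Rightarrow> nat pair_pre_digraph" where
  "riordan_graph_of n g f = \<lparr>pverts = {1..n}, parcs = {(u, v). u \<in> {1..n} \<and> v \<in> {1..n} \<and>
     odd (riordan_matrix (fps_X * g) f (u - 1) (v - 1) +
          riordan_matrix (fps_X * g) f (v - 1) (u - 1))}\<rparr>"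

lemma riordan_graph_iff:
  "riordan_graph n G \<longleftrightarrow> (\<exists>g f. fps_nth f 0 = 0 \<and> G = riordan_graph_of n g f)"
proof -
  have cong: "mat_cong (adjacency_matrix n G) (R + transpose_mat R) 2 \<longleftrightarrow>
      (\<forall>i<n. \<forall>j<n. (i + 1, j + 1) \<in> parcs G \<longleftrightarrow> odd (L i j + L j i))"
    if "R = leading_submatrix n L" for L R
    using that
    by (auto simp: mat_cong_def adjacency_matrix_def leading_submatrix_def cong_def mod_2_eq_odd
        split: if_splits)
  show ?thesis
  proof
    assume "riordan_graph n G"
    then obtain g f where pg: "pair_graph G" "pverts G = {1..n}" and f: "fps_nth f 0 = 0"
      and c: "\<And>i j. i < n \<Longrightarrow> j < n \<Longrightarrow> (i + 1, j + 1) \<in> parcs G \<longleftrightarrow>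
        odd (riordan_matrix (fps_X * g) f i j + riordan_matrix (fps_X * g) f j i)"
      unfolding riordan_graph_def Let_def cong[OF refl] by blast
    interpret pair_graph G by (fact pg)
    have "(u, v) \<in> parcs G \<longleftrightarrow> (u, v) \<in> parcs (riordan_graph_of n g f)" for u v
    proof (cases "u \<in> {1..n} \<and> v \<in> {1..n}")
      case True
      then have "u - 1 < n" "v - 1 < n" "u - 1 + 1 = u" "v - 1 + 1 = v"
        by auto
      with True show ?thesis
        using c[of "u - 1" "v - 1"] by (simp add: riordan_graph_of_def)
    next
      case False
      then show ?thesis
        using in_arcsD1[of u v] in_arcsD2[of u v] pg(2) by (auto simp: riordan_graph_of_def)
    qed
    then have "parcs G = parcs (riordan_graph_of n g f)"
      by auto
    then have "G = riordan_graph_of n g f"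
      using pg(2) by (intro pair_pre_digraph.equality) (auto simp: riordan_graph_of_def)
    with f show "\<exists>g f. fps_nth f 0 = 0 \<and> G = riordan_graph_of n g f"
      by blast
  next
    assume "\<exists>g f. fps_nth f 0 = 0 \<and> G = riordan_graph_of n g f"
    then obtain g f where f: "fps_nth f 0 = 0" and G: "G = riordan_graph_of n g f"
      by blast
    have "parcs G \<subseteq> {1..n} \<times> {1..n}"
      by (auto simp: G riordan_graph_of_def)
    then have "finite (parcs G)"
      by (rule finite_subset) simp
    then have "pair_graph G"
      by unfold_locales
         (auto simp: G riordan_graph_of_def symmetric_def add.commute intro!: symI)
    moreover have "\<forall>i<n. \<forall>j<n. (i + 1, j + 1) \<in> parcs G \<longleftrightarrow>
        odd (riordan_matrix (fps_X * g) f i j + riordan_matrix (fps_X * g) f j i)"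
      by (auto simp: G riordan_graph_of_def)
    ultimately show "riordan_graph n G"
      unfolding riordan_graph_def Let_def cong[OF refl]
      using f by (auto simp: G riordan_graph_of_def)
  qed
qed

lemma riordan_matrix_strictly_lower:
  assumes "fps_nth f 0 = 0" "i \<le> j"
  shows "riordan_matrix (fps_X * g) f i j = 0"
proof (cases i)
  case (Suc k)
  have "fps_nth (g * f ^ j) k = 0"
    using assms Suc startsby_zero_power_prefix[OF assms(1), of j]
    by (auto simp: fps_mult_nth intro!: sum.neutral)
  then show ?thesis
    using Suc by (simp add: riordan_matrix_def mult.assoc)
qed (simp add: riordan_matrix_def mult.assoc)

text \<open>Because the Riordan matrix is strictly lower triangular, its entries and those of its transpose
  do not interfere in the adjacency matrix, which therefore determines all the parities.\<close>

lemma riordan_graph_of_eq_iff: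
  assumes f: "fps_nth f 0 = 0" and f': "fps_nth f' 0 = 0"
  shows "riordan_graph_of n g f = riordan_graph_of n g' f' \<longleftrightarrow>
    (\<forall>j<n. even_below n (fps_X * g * f ^ j - fps_X * g' * f' ^ j))"
    (is "?L \<longleftrightarrow> ?R")
proof -
  define M where "M = riordan_matrix (fps_X * g) f"
  define M' where "M' = riordan_matrix (fps_X * g') f'"
  have low: "M i j = 0" "M' i j = 0" if "i \<le> j" for i j
    using that f f' by (auto simp: M_def M'_def riordan_matrix_strictly_lower)
  have R: "?R \<longleftrightarrow> (\<forall>i<n. \<forall>j<n. odd (M i j) \<longleftrightarrow> odd (M' i j))"
    by (auto simp: even_below_def M_def M'_def riordan_matrix_def)
  show ?thesis
  proof
    assume L: ?L
    have "odd (M i j) \<longleftrightarrow> odd (M' i j)" if ij: "i < n" "j < n" for i j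
    proof (cases "i \<le> j")
      case False
      have "(i + 1, j + 1) \<in> parcs (riordan_graph_of n g f) \<longleftrightarrow>
          (i + 1, j + 1) \<in> parcs (riordan_graph_of n g' f')"
        using L by simp
      then show ?thesis
        using ij False low[of j i] by (simp add: riordan_graph_of_def flip: M_def M'_def)
    qed (simp add: low)
    then show ?R
      unfolding R by blast
  next
    assume ?R
    then have "odd (M i j) \<longleftrightarrow> odd (M' i j)" if "i < n" "j < n" for i j
      using that unfolding R by blast
    then have "odd (M (u - 1) (v - 1) + M (v - 1) (u - 1)) \<longleftrightarrow>
        odd (M' (u - 1) (v - 1) + M' (v - 1) (u - 1))" if "u \<in> {1..n}" "v \<in> {1..n}" for u v
    proof -
      have "u - 1 < n" "v - 1 < n"
        using that by auto
      with \<open>\<And>i j. i < n \<Longrightarrow> j < n \<Longrightarrow> odd (M i j) \<longleftrightarrow> odd (M' i j)\<close> show ?thesis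
        by simp
    qed
    then show ?L
      by (auto simp: riordan_graph_of_def simp flip: M_def M'_def)
  qed
qed

section \<open>Riordan graphs and bars\<close>

text \<open>The shift is chosen so that the coefficient of \<open>t\<^sup>i\<close> in \<open>tg\<close> is 1 if \<open>n + i\<close> is a bar. The bar \<open>2n\<close>
  belongs to the degree \<open>n\<close>, outside the matrix; it makes \<open>q\<close> the lowest degree of \<open>tg\<close> even if \<open>tg\<close>
  vanishes below degree \<open>n\<close>.\<close>

definition bars_g :: "nat \<Rightarrow> nat set \<Rightarrow> int fps" where
  "bars_g n E = Abs_fps (\<lambda>i. of_bool (n + 1 + i \<in> E))"

text \<open>The bars from \<open>n - q\<close> on contribute terms to \<open>f\<close> as well, but in degrees that the graph does not
  see. Therefore \<open>q\<close> does not occur in the definition.\<close>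

definition bars_f :: "nat set \<Rightarrow> int fps" where
  "bars_f E = Abs_fps (\<lambda>j. of_bool (0 < j \<and> j \<in> E))"

lemma nth_X_bars_g: "fps_nth (fps_X * bars_g n E) i = of_bool (0 < i \<and> n + i \<in> E)"
  by (cases i) (auto simp: bars_g_def)

lemma bars_f_0: "fps_nth (bars_f E) 0 = 0"
  by (simp add: bars_f_def)

lemma even_below_X_bars_g:
  assumes "central_part n E q"
  shows "even_below q (fps_X * bars_g n E)" "odd (fps_nth (fps_X * bars_g n E) q)"
  unfolding even_below_def nth_X_bars_g using assms by (auto simp: central_part_def)

text \<open>The first column of the matrix gives back the bars above \<open>n\<close>, hence \<open>q\<close>; the second column,
  after cancellation of \<open>tg\<close>, gives back the bars below \<open>n - q\<close>.\<close>

lemma inj_on_riordan_graph_of_bars: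
  assumes "1 \<le> n"
  shows "inj_on (\<lambda>E. riordan_graph_of n (bars_g n E) (bars_f E)) (central_bar_sets n)"
proof (rule inj_onI)
  fix E E' assume E: "E \<in> central_bar_sets n" and E': "E' \<in> central_bar_sets n"
    and eq: "riordan_graph_of n (bars_g n E) (bars_f E) =
      riordan_graph_of n (bars_g n E') (bars_f E')"
  let ?a = "fps_X * bars_g n E" and ?a' = "fps_X * bars_g n E'"
  obtain q q' where q: "central_part n E q" and q': "central_part n E' q'"
    using E E' by (auto simp: central_bar_sets_def)
  have ends: "0 \<in> E" "2 * n \<in> E" "0 \<in> E'" "2 * n \<in> E'"
    and sub: "E \<subseteq> {0..2 * n}" "E' \<subseteq> {0..2 * n}"
    using E E' by (auto simp: central_bar_sets_def bar_sets_def)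
  have cols: "even_below n (?a * bars_f E ^ j - ?a' * bars_f E' ^ j)" if "j < n" for j
    using eq that riordan_graph_of_eq_iff[OF bars_f_0 bars_f_0] by blast
  have aa': "even_below n (?a - ?a')"
    using cols[of 0] assms by simp
  have upper: "n + i \<in> E \<longleftrightarrow> n + i \<in> E'" if "0 < i" "i \<le> n" for i
  proof (cases "i = n")
    case True
    then show ?thesis using ends by (simp add: mult_2)
  next
    case False
    then have "i < n"
      using that by simp
    then have "even (fps_nth ?a i - fps_nth ?a' i)"
      using aa' unfolding even_below_def fps_sub_nth by blast
    then show ?thesis
      using that unfolding nth_X_bars_g by (auto split: if_splits)
  qed
  have "q = q'"
  proof (rule ccontr)
    assume "q \<noteq> q'"
    then consider "q < q'" | "q' < q" by linarith
    then show False
      using q q' upper[of q] upper[of q'] by cases (auto simp: central_part_def)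
  qed
  \<comment> \<open>For \<open>n = 1\<close> there is no second column, but then \<open>n - q = 0\<close>.\<close>
  have ff': "even_below (n - q) (bars_f E - bars_f E')"
  proof (cases "1 < n")
    case True
    have "?a * (bars_f E - bars_f E') =
        (?a * bars_f E ^ 1 - ?a' * bars_f E' ^ 1) - (?a - ?a') * bars_f E'"
      by (simp add: algebra_simps)
    moreover have "even_below (n + 0) ((?a - ?a') * bars_f E')"
      by (intro even_below_mult aa') (simp add: even_below_def)
    ultimately have "even_below n (?a * (bars_f E - bars_f E'))"
      using cols[OF True] by (auto simp: even_below_def)
    then show ?thesis
      using even_below_mult_cancel even_below_X_bars_g[OF q] by blast
  next
    case False
    then show ?thesis
      using q by (auto simp: central_part_def even_below_def)
  qed
  have lower: "j \<in> E \<longleftrightarrow> j \<in> E'" if "0 < j" "j < n - q" for j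
  proof -
    have "even (fps_nth (bars_f E) j - fps_nth (bars_f E') j)"
      using ff' that by (simp add: even_below_def)
    then show ?thesis
      using that by (auto simp: bars_f_def split: if_splits)
  qed
  have "e \<in> E \<longleftrightarrow> e \<in> E'" for e
  proof -
    consider "e = 0" | "0 < e" "e < n - q" | "e = n - q" | "n - q < e" "e < n + q"
      | "n + q \<le> e" "e \<le> 2 * n" | "2 * n < e"
      by linarith
    then show ?thesis
    proof cases
      case 5
      then show ?thesis
        using upper[of "e - n"] q by (auto simp: central_part_def)
    qed (use ends lower q q' \<open>q = q'\<close> sub in \<open>auto simp: central_part_def\<close>)
  qed
  then show "E = E'" by auto
qed

text \<open>The parities of the given \<open>g\<close> and \<open>f\<close>, in the degrees that matter, are written into the bars.\<close>

lemma riordan_graph_of_bars_surj: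
  assumes n: "1 \<le> n" and f: "fps_nth f 0 = 0"
  shows "\<exists>E \<in> central_bar_sets n.
    riordan_graph_of n (bars_g n E) (bars_f E) = riordan_graph_of n g f"
proof -
  let ?a = "fps_X * g"
  \<comment> \<open>If no coefficient of \<open>tg\<close> below degree \<open>n\<close> is odd, then \<open>q = n\<close>, the only bars are the two
    ends, and the graph has no edges.\<close>
  define q where "q = (LEAST i. i = n \<or> odd (fps_nth ?a i))"
  have q_prop: "q = n \<or> odd (fps_nth ?a q)"
    unfolding q_def by (rule LeastI[of _ n]) simp
  have q_le: "q \<le> n"
    unfolding q_def by (rule Least_le) simp
  have q_least: "even (fps_nth ?a i)" if "i < q" for i
    using not_less_Least[of i "\<lambda>i. i = n \<or> odd (fps_nth ?a i)"] that by (auto simp: q_def)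
  have q_pos: "1 \<le> q"
    using q_prop n by (cases "q = 0") auto
  define E where "E = {0, n - q, 2 * n} \<union> {j. j < n - q \<and> odd (fps_nth f j)} \<union>
    {n + i | i. i < n \<and> odd (fps_nth ?a i)}"
  have "E \<in> bar_sets (2 * n)"
    by (auto simp: E_def bar_sets_def)
  moreover have part: "central_part n E q"
    using q_prop q_le q_pos q_least
    by (auto simp: E_def central_part_def mult_2 simp del: fps_X_mult_nth)
  ultimately have E: "E \<in> central_bar_sets n"
    by (auto simp: central_bar_sets_def)
  have memg: "0 < i \<and> n + i \<in> E \<longleftrightarrow> odd (fps_nth ?a i)" if "i < n" for i
    using that q_pos n by (cases i) (auto simp: E_def)
  have memf: "0 < j \<and> j \<in> E \<longleftrightarrow> odd (fps_nth f j)" if "j < n - q" for j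
    using that q_pos f by (cases j) (auto simp: E_def)
  have "even_below n (fps_X * bars_g n E - ?a)"
    unfolding even_below_def fps_sub_nth nth_X_bars_g using memg by simp
  moreover have "even_below (n - q) (bars_f E - f)"
    unfolding even_below_def using memf by (simp add: bars_f_def)
  ultimately have "riordan_graph_of n (bars_g n E) (bars_f E) = riordan_graph_of n g f"
    using even_below_mult_power_diff[OF even_below_X_bars_g(1)[OF part]]
    by (simp add: riordan_graph_of_eq_iff[OF bars_f_0 f])
  with E show ?thesis by blast
qed

lemma bij_betw_central_bar_sets_riordan_graphs:
  assumes "1 \<le> n"
  shows "bij_betw (\<lambda>E. riordan_graph_of n (bars_g n E) (bars_f E))
    (central_bar_sets n) (riordan_graphs n)"
  unfolding bij_betw_def
proof
  show "(\<lambda>E. riordan_graph_of n (bars_g n E) (bars_f E)) ` central_bar_sets n = riordan_graphs n"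
    (is "?\<Gamma> ` _ = _")
  proof
    show "?\<Gamma> ` central_bar_sets n \<subseteq> riordan_graphs n"
      using bars_f_0 by (auto simp: riordan_graphs_def riordan_graph_iff)
    show "riordan_graphs n \<subseteq> ?\<Gamma> ` central_bar_sets n"
    proof
      fix G assume "G \<in> riordan_graphs n"
      then obtain g f where "fps_nth f 0 = 0" "G = riordan_graph_of n g f"
        by (auto simp: riordan_graphs_def riordan_graph_iff)
      then obtain E where "E \<in> central_bar_sets n" "G = ?\<Gamma> E"
        using riordan_graph_of_bars_surj[OF assms, of f g] by auto
      then show "G \<in> ?\<Gamma> ` central_bar_sets n"
        by blast
    qed
  qed
qed (rule inj_on_riordan_graph_of_bars[OF assms])

theorem theorem3p1:
  fixes n :: nat
  assumes "n \<ge> 1"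
  shows "\<exists>\<phi>. bij_betw \<phi> (riordan_graphs n) (avoiders_two_fixed (2 * n))"
  using bij_betw_trans[OF
      bij_betw_inv_into[OF bij_betw_central_bar_sets_riordan_graphs[OF assms]]
      bij_betw_central_bar_sets_avoiders[OF assms]]
  by blast

end
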